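(* Suppose there is $\gamma\ge\tfrac12$ and a representative $\tilde\kappa_P$ in the equivalence class of Markov kernels for $P_{Y|X}$ such that for every $g\in\mathcal H_\ell$ the map $x\mapsto\int_{\mathcal Y}g(y)\,\tilde\kappa_P(x,dy)$ belongs to $\mathrm{range}(C_{XX}^{\gamma})$, and that the analogous condition holds for $Q_{Z|X}$ with a representative $\tilde\kappa_Q$. Let $\Delta=C_{Y|X}-C_{Z|X}$. Then the squared $\mathrm{CMMD}_1$ satisfies $$\mathrm{CMMD}_1^2(P_{Y|X},Q_{Z|X})=\mathrm{Tr}(\Delta^*\Delta\,C_{XX}),$$ where $C_{XX}$ is the covariance operator of $R_X$.
   Context: $P$ and $Q$ are probability measures on a measurable space; $X$ takes values in a topological space $\mathcal X$ with its Borel $\sigma$-algebra and $Y,Z$ take values in a measurable space $(\mathcal Y,\mathfrak Y)$. $P_X,Q_X$ are the laws of $X$ under $P,Q$; they have full support and are mutually absolutely continuous. $P_{Y|X}$ is the conditional distribution of $Y$ given $X$ under $P$ and $Q_{Z|X}$ that of $Z$ given $X$ under $Q$; both admit regular versions, represented by equivalence classes (equality for almost every $x$) of Markov kernels $\mathcal X\times\mathfrak Y\to[0,1]$. For a fixed $\alpha\in[0,1]$, $R_X=\alpha P_X+(1-\alpha)Q_X$. $k:\mathcal X\times\mathcal X\to\mathbb R$ and $\ell:\mathcal Y\times\mathcal Y\to\mathbb R$ are measurable positive definite kernels with RKHSs $\mathcal H_k$ (separable) and $\mathcal H_\ell$; $k$ is continuous and bounded ($k(x,x)\le k_{\max}$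 for all $x$). $C_{XX}=\mathbb E_{X\sim R_X}[k(\cdot,X)\otimes k(\cdot,X)]$ is the covariance operator on $\mathcal H_k$, i.e. $\langle f,C_{XX}f'\rangle_{\mathcal H_k}=\mathbb E_{X\sim R_X}[f(X)f'(X)]$. The conditional mean operator $C_{Y|X}:\mathcal H_k\to\mathcal H_\ell$ is the adjoint of $C_{Y|X}^*:\mathcal H_\ell\to\mathcal H_k$, $(C_{Y|X}^*g)(x)=\int g(y)\,\tilde\kappa_P(x,dy)$; $C_{Z|X}$ is defined likewise from $\tilde\kappa_Q$. The conditional mean embeddings are $\mu_{Y|x}=\int\ell(\cdot,y)\,\tilde\kappa_P(x,dy)\in\mathcal H_\ell$ and $\mu_{Z|x}=\int\ell(\cdot,z)\,\tilde\kappa_Q(x,dz)\in\mathcal H_\ell$, and $$\mathrm{CMMD}_1(P_{Y|X},Q_{Z|X})=\sqrt{\mathbb E_{X\sim R_X}\|\mu_{Y|X}-\mu_{Z|X}\|_{\mathcal H_\ell}^2}.$$ *)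

theory Defs
  imports "HOL-Probability.Probability"
begin

section \<open>Reproducing kernel Hilbert spaces\<close>

definition pos_def_kernel :: "'a set \<Rightarrow> ('a \<Rightarrow> 'a \<Rightarrow> real) \<Rightarrow> bool" where
  "pos_def_kernel S k \<longleftrightarrow>
     (\<forall>x\<in>S. \<forall>y\<in>S. k x y = k y x) \<and>
     (\<forall>F a. finite F \<longrightarrow> F \<subseteq> S \<longrightarrow> 0 \<le> (\<Sum>x\<in>F. \<Sum>y\<in>F. a x * a y * k x y))"

text \<open>
  The RKHS of a kernel \<open>k\<close> on the set \<open>S\<close> is a Hilbert space of functions on \<open>S\<close> that contains
  every \<open>k(\<cdot>, x)\<close> and satisfies \<open>f(x) = \<langle>f, k(\<cdot>, x)\<rangle>\<close>. The Hilbert space is a type \<open>'h\<close>; its elements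
  are identified with functions through the linear map \<open>evh\<close> (\<open>evh f x\<close> is the value of \<open>f\<close> at \<open>x\<close>),
  which is injective into the functions on \<open>S\<close>. By the Moore--Aronszajn theorem these properties
  determine the function space and its inner product. Values of \<open>evh f\<close> outside \<open>S\<close> are irrelevant.
\<close>

locale rkhs =
  fixes S :: "'a set"
    and k :: "'a \<Rightarrow> 'a \<Rightarrow> real"
    and evh :: "'h::{real_inner, banach} \<Rightarrow> 'a \<Rightarrow> real"
  assumes ev_add: "x \<in> S \<Longrightarrow> evh (f + g) x = evh f x + evh g x"
    and ev_scaleR: "x \<in> S \<Longrightarrow> evh (c *\<^sub>R f) x = c * evh f x"
    and ev_inject: "(\<And>x. x \<in> S \<Longrightarrow> evh f x = evh g x) \<Longrightarrow> f = g"
    and reproducing: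
      "x \<in> S \<Longrightarrow> \<exists>\<phi>. (\<forall>x'\<in>S. evh \<phi> x' = k x' x) \<and> (\<forall>f. evh f x = f \<bullet> \<phi>)"

text \<open>The element of the RKHS that is the function \<open>u\<close> on \<open>S\<close>; meaningful only if there is one.\<close>

definition rkhs_elem :: "'a set \<Rightarrow> ('h \<Rightarrow> 'a \<Rightarrow> real) \<Rightarrow> ('a \<Rightarrow> real) \<Rightarrow> 'h" where
  "rkhs_elem S evh u = (THE f. \<forall>x\<in>S. evh f x = u x)"

definition canonical_feature ::
    "'a set \<Rightarrow> ('a \<Rightarrow> 'a \<Rightarrow> real) \<Rightarrow> ('h \<Rightarrow> 'a \<Rightarrow> real) \<Rightarrow> 'a \<Rightarrow> 'h" where
  "canonical_feature S k evh x = rkhs_elem S evh (\<lambda>x'. k x' x)"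


section \<open>Operators on Hilbert spaces\<close>

definition orthonormal_basis :: "'h::real_inner set \<Rightarrow> bool" where
  "orthonormal_basis B \<longleftrightarrow>
     pairwise orthogonal B \<and> (\<forall>e\<in>B. norm e = 1) \<and> closure (span B) = UNIV"

definition rank_one :: "'g \<Rightarrow> 'h::real_inner \<Rightarrow> 'h \<Rightarrow> 'g::real_vector" where
  "rank_one a b = (\<lambda>f. (b \<bullet> f) *\<^sub>R a)"

text \<open>
  Real power of a compact positive self-adjoint operator \<open>A\<close> through its spectral decomposition
  \<open>A = \<Sum> \<lambda>\<^sub>e e \<otimes> e\<close> over an orthonormal basis of eigenvectors, where \<open>\<lambda>\<^sub>e = \<langle>e, A e\<rangle>\<close>.
  For \<open>\<gamma> > 0\<close> the value does not depend on the chosen eigenbasis, and \<open>0 powr \<gamma> = 0\<close>.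
\<close>

definition op_powr :: "('h \<Rightarrow> 'h) \<Rightarrow> real \<Rightarrow> 'h \<Rightarrow> 'h::{real_inner, banach}" where
  "op_powr A \<gamma> f =
     (let B = (SOME B. orthonormal_basis B \<and> (\<forall>e\<in>B. \<exists>c. A e = c *\<^sub>R e))
      in \<Sum>\<^sub>\<infinity>e\<in>B. ((e \<bullet> A e) powr \<gamma> * (e \<bullet> f)) *\<^sub>R e)"

text \<open>
  The trace is the common value of \<open>\<Sum> \<langle>e, A e\<rangle>\<close> over all orthonormal bases; if the sum fails to
  converge for some basis, or depends on the basis, then \<open>op_trace A\<close> is unspecified.
\<close>

definition has_trace :: "('h::real_inner \<Rightarrow> 'h) \<Rightarrow> real \<Rightarrow> bool" where
  "has_trace A t \<longleftrightarrow> (\<forall>B. orthonormal_basis B \<longrightarrow> ((\<lambda>e. e \<bullet> A e) has_sum t) B)"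

definition op_trace :: "('h::real_inner \<Rightarrow> 'h) \<Rightarrow> real" where
  "op_trace A = (THE t. has_trace A t)"

text \<open>\<open>E\<^sub>R[\<phi>(X) \<otimes> \<phi>(X)]\<close>, with the expectation taken in the strong operator sense.\<close>

definition cov_op ::
    "'a measure \<Rightarrow> ('a \<Rightarrow> 'h) \<Rightarrow> 'h \<Rightarrow> 'h::{real_inner, banach, second_countable_topology}" where
  "cov_op R \<phi> f = (\<integral>x. rank_one (\<phi> x) (\<phi> x) f \<partial>R)"


section \<open>Measures and conditional distributions\<close>

definition full_support :: "'a::topological_space measure \<Rightarrow> bool" where
  "full_support \<mu> \<longleftrightarrow> (\<forall>U. open U \<longrightarrow> U \<noteq> {} \<longrightarrow> 0 < emeasure \<mu> U)"

definition mixture :: "real \<Rightarrow> 'a measure \<Rightarrow> 'a measure \<Rightarrow> 'a measure" where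
  "mixture \<alpha> \<mu> \<nu> = measure_of (space \<mu>) (sets \<mu>)
     (\<lambda>A. ennreal \<alpha> * emeasure \<mu> A + ennreal (1 - \<alpha>) * emeasure \<nu> A)"

lemma sets_mixture [simp]: "sets (mixture \<alpha> \<mu> \<nu>) = sets \<mu>"
  and space_mixture [simp]: "space (mixture \<alpha> \<mu> \<nu>) = space \<mu>"
  by (simp_all add: mixture_def)

lemma emeasure_mixture:
  assumes "sets \<nu> = sets \<mu>" "A \<in> sets \<mu>"
  shows "emeasure (mixture \<alpha> \<mu> \<nu>) A = ennreal \<alpha> * emeasure \<mu> A + ennreal (1 - \<alpha>) * emeasure \<nu> A"
proof (rule emeasure_measure_of[OF mixture_def])
  show "countably_additive (sets (mixture \<alpha> \<mu> \<nu>))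
      (\<lambda>A. ennreal \<alpha> * emeasure \<mu> A + ennreal (1 - \<alpha>) * emeasure \<nu> A)"
  proof (rule countably_additiveI)
    fix F :: "nat \<Rightarrow> 'a set"
    assume F: "range F \<subseteq> sets (mixture \<alpha> \<mu> \<nu>)" "disjoint_family F"
    have "(\<Sum>i. ennreal \<alpha> * emeasure \<mu> (F i) + ennreal (1 - \<alpha>) * emeasure \<nu> (F i))
        = ennreal \<alpha> * (\<Sum>i. emeasure \<mu> (F i)) + ennreal (1 - \<alpha>) * (\<Sum>i. emeasure \<nu> (F i))"
      by (subst suminf_add[symmetric]) (auto simp: ennreal_suminf_cmult)
    also have "(\<Sum>i. emeasure \<mu> (F i)) = emeasure \<mu> (\<Union>i. F i)"
      using F by (intro suminf_emeasure) auto
    also have "(\<Sum>i. emeasure \<nu> (F i)) = emeasure \<nu> (\<Union>i. F i)"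
      using F assms by (intro suminf_emeasure) auto
    finally show "(\<Sum>i. ennreal \<alpha> * emeasure \<mu> (F i) + ennreal (1 - \<alpha>) * emeasure \<nu> (F i))
        = ennreal \<alpha> * emeasure \<mu> (\<Union>i. F i) + ennreal (1 - \<alpha>) * emeasure \<nu> (\<Union>i. F i)" .
  qed
qed (use assms sets.sets_into_space in \<open>auto simp: positive_def\<close>)

text \<open>
  \<open>\<kappa>\<close> is a regular version of the conditional distribution of \<open>Y\<close> given \<open>X\<close> under \<open>P\<close>: a Markov
  kernel from \<open>S\<close> to \<open>N\<close> with \<open>P(Y \<in> B | X) = \<kappa>(X, B)\<close> almost surely, for each measurable \<open>B\<close>.
\<close>

definition regular_cond_distr ::
    "'w measure \<Rightarrow> 'x measure \<Rightarrow> ('w \<Rightarrow> 'x) \<Rightarrow> 'y measure \<Rightarrow> ('w \<Rightarrow> 'y) \<Rightarrow> ('x \<Rightarrow> 'y measure) \<Rightarrow> bool"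
  where
  "regular_cond_distr P S X N Y \<kappa> \<longleftrightarrow>
     \<kappa> \<in> S \<rightarrow>\<^sub>M prob_algebra N \<and>
     (\<forall>B\<in>sets N. AE \<omega> in P.
        real_cond_exp P (vimage_algebra (space P) X S) (indicator (Y -` B \<inter> space P)) \<omega>
          = measure (\<kappa> (X \<omega>)) B)"


section \<open>Conditional mean embeddings and operators\<close>

text \<open>
  \<open>\<mu> = \<integral> \<ell>(\<cdot>, y) \<nu>(dy)\<close> as a function on \<open>space N\<close>. No separability of the RKHS of \<open>\<ell>\<close> is assumed,
  hence no Bochner integral in \<open>'h\<close>; where that exists, it is this element.
\<close>

definition mean_embedding ::
    "'y measure \<Rightarrow> ('y \<Rightarrow> 'y \<Rightarrow> real) \<Rightarrow> ('h \<Rightarrow> 'y \<Rightarrow> real) \<Rightarrow> 'y measure \<Rightarrow> 'h" where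
  "mean_embedding N l evl \<nu> = rkhs_elem (space N) evl (\<lambda>y'. \<integral>y. l y' y \<partial>\<nu>)"

text \<open>\<open>(C\<^sup>* g)(x) = \<integral> g(y) \<kappa>(x, dy)\<close>, as an operator between the two RKHSs.\<close>

definition cond_mean_op_adj ::
    "('hx \<Rightarrow> 'x \<Rightarrow> real) \<Rightarrow> ('hy \<Rightarrow> 'y \<Rightarrow> real) \<Rightarrow> ('x \<Rightarrow> 'y measure) \<Rightarrow> 'hy \<Rightarrow> 'hx" where
  "cond_mean_op_adj evk evl \<kappa> g = rkhs_elem UNIV evk (\<lambda>x. \<integral>y. evl g y \<partial>\<kappa> x)"

definition cond_mean_op ::
    "('hx::real_inner \<Rightarrow> 'x \<Rightarrow> real) \<Rightarrow> ('hy::real_inner \<Rightarrow> 'y \<Rightarrow> real) \<Rightarrow> ('x \<Rightarrow> 'y measure) \<Rightarrow> 'hx \<Rightarrow> 'hy"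
  where
  "cond_mean_op evk evl \<kappa> = adjoint (cond_mean_op_adj evk evl \<kappa>)"

text \<open>
  For all \<open>g\<close>, the map \<open>x \<mapsto> \<integral> g(y) \<kappa>(x, dy)\<close> is well defined and lies in the range of \<open>C\<^sup>\<gamma>\<close>.
  The integrability clause is needed since a Bochner integral is 0 if the integrand is not integrable.
\<close>

definition source_condition ::
    "('hx::{real_inner, banach} \<Rightarrow> 'x \<Rightarrow> real) \<Rightarrow> ('hy \<Rightarrow> 'y \<Rightarrow> real) \<Rightarrow> ('hx \<Rightarrow> 'hx) \<Rightarrow> real
      \<Rightarrow> ('x \<Rightarrow> 'y measure) \<Rightarrow> bool" where
  "source_condition evk evl C \<gamma> \<kappa> \<longleftrightarrow>
     (\<forall>g. (\<forall>x. integrable (\<kappa> x) (evl g)) \<and>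
          (\<lambda>x. \<integral>y. evl g y \<partial>\<kappa> x) \<in> evk ` range (op_powr C \<gamma>))"

definition cmmd1 ::
    "'x measure \<Rightarrow> 'y measure \<Rightarrow> ('y \<Rightarrow> 'y \<Rightarrow> real) \<Rightarrow> ('hy::real_inner \<Rightarrow> 'y \<Rightarrow> real)
      \<Rightarrow> ('x \<Rightarrow> 'y measure) \<Rightarrow> ('x \<Rightarrow> 'y measure) \<Rightarrow> real" where
  "cmmd1 R N l evl \<kappa>P \<kappa>Q =
     sqrt (\<integral>x. (norm (mean_embedding N l evl (\<kappa>P x) - mean_embedding N l evl (\<kappa>Q x)))\<^sup>2 \<partial>R)"

end

theory Submission
  imports Defs
begin

text \<open>
  The source condition puts \<open>x \<mapsto> \<integral> g d\<kappa>\<^sub>x\<close> into the RKHS of \<open>k\<close> for every \<open>g\<close>, so \<open>C\<^sup>*\<close> is defined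
  everywhere. Baire's theorem makes it bounded: first each functional \<open>g \<mapsto> \<integral> g d\<kappa>\<^sub>x\<close> is bounded,
  since \<open>g \<mapsto> \<integral> \<bar>g\<bar> d\<kappa>\<^sub>x\<close> is lower semicontinuous by Fatou's lemma, and then
  \<open>g \<mapsto> \<parallel>C\<^sup>* g\<parallel>\<close> is lower semicontinuous because the features span a dense subspace. Hence \<open>C\<close>
  exists by the Riesz representation theorem, and it maps the feature \<open>\<phi> x\<close> to the embedding of
  \<open>\<kappa>\<^sub>x\<close>. For an orthonormal basis \<open>B\<close>, expanding \<open>\<phi> x\<close> in \<open>B\<close> turns
  \<open>\<Sum>\<^sub>e \<langle>e, D C\<^sub>X\<^sub>X e\<rangle> = \<integral> \<Sum>\<^sub>e \<langle>\<phi> x, e\<rangle> \<langle>e, D \<phi> x\<rangle> dR\<close> into \<open>\<integral> \<langle>\<phi> x, D \<phi> x\<rangle> dR\<close>; take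
  \<open>D = \<Delta>\<^sup>* \<Delta>\<close>.
\<close>

section \<open>Orthogonality in Hilbert spaces\<close>

text \<open>A minimizing sequence for the distance is Cauchy: midpoints stay in \<open>S\<close>, so
  the parallelogram law controls its gaps. Its limit attains the distance, and optimality along each
  direction \<open>s\<close> forces orthogonality.\<close>

lemma orthogonal_projection_exists:
  fixes S :: "'a::{real_inner,banach} set" and x :: 'a
  assumes "closed S" and "subspace S"
  obtains p where "p \<in> S" and "\<And>s. s \<in> S \<Longrightarrow> (x - p) \<bullet> s = 0"
proof -
  define d where "d = (INF s\<in>S. (norm (x - s))\<^sup>2)"
  have bdd: "bdd_below ((\<lambda>s. (norm (x - s))\<^sup>2) ` S)"
    by (intro bdd_belowI2[where m = 0]) simp
  have d_le: "d \<le> (norm (x - s))\<^sup>2" if "s \<in> S" for s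
    unfolding d_def by (rule cINF_lower[OF bdd that])
  have ne: "S \<noteq> {}"
    using subspace_0[OF assms(2)] by auto
  have "\<exists>s\<in>S. (norm (x - s))\<^sup>2 < d + 1 / Suc n" for n
  proof -
    have "(INF s\<in>S. (norm (x - s))\<^sup>2) < d + 1 / Suc n"
      unfolding d_def by simp
    then show ?thesis
      using cINF_less_iff[OF ne bdd] by blast
  qed
  then obtain f where f: "\<And>n. f n \<in> S" "\<And>n. (norm (x - f n))\<^sup>2 < d + 1 / Suc n"
    by metis
  \<comment> \<open>parallelogram law\<close>
  have dist2: "(norm (s - t))\<^sup>2 \<le> 2 * (norm (x - s))\<^sup>2 + 2 * (norm (x - t))\<^sup>2 - 4 * d"
    if "s \<in> S" "t \<in> S" for s t
  proof -
    have "(1/2) *\<^sub>R (s + t) \<in> S"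
      using that assms(2) by (intro subspace_scale subspace_add)
    then have "d \<le> (norm (x - (1/2) *\<^sub>R (s + t)))\<^sup>2"
      by (rule d_le)
    moreover have "(norm (s - t))\<^sup>2 = 2 * (norm (x - s))\<^sup>2 + 2 * (norm (x - t))\<^sup>2
        - 4 * (norm (x - (1/2) *\<^sub>R (s + t)))\<^sup>2"
      unfolding power2_norm_eq_inner by (simp add: algebra_simps inner_commute)
    ultimately show ?thesis by linarith
  qed
  have "Cauchy f"
  proof (rule metric_CauchyI)
    fix e :: real assume "0 < e"
    \<comment> \<open>In \<open>dist2\<close> the terms in \<open>d\<close> cancel, leaving at most
      \<open>4 / Suc M\<close>; hence the quarter.\<close>
    then obtain M where M: "inverse (real (Suc M)) < e\<^sup>2 / 4"
      using reals_Archimedean[of "e\<^sup>2 / 4"] by auto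
    have "dist (f m) (f n) < e" if "M \<le> m" "M \<le> n" for m n
    proof -
      have "1 / real (Suc m) \<le> 1 / real (Suc M)" "1 / real (Suc n) \<le> 1 / real (Suc M)"
        using that by (simp_all add: frac_le)
      then have "(norm (f m - f n))\<^sup>2 < e\<^sup>2"
        using dist2[OF f(1)[of m] f(1)[of n]] f(2)[of m] f(2)[of n] M
        unfolding inverse_eq_divide by linarith
      then show ?thesis
        using \<open>0 < e\<close> by (simp add: dist_norm power_less_imp_less_base)
    qed
    then show "\<exists>M. \<forall>m\<ge>M. \<forall>n\<ge>M. dist (f m) (f n) < e" by blast
  qed
  then obtain p where p: "f \<longlonglongrightarrow> p"
    using Cauchy_convergent_iff convergent_def by blast
  have pS: "p \<in> S"
    using closed_sequentially[OF assms(1) _ p] f(1) by auto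
  have "(norm (x - p))\<^sup>2 \<le> d"
  proof (rule LIMSEQ_le)
    show "(\<lambda>n. (norm (x - f n))\<^sup>2) \<longlonglongrightarrow> (norm (x - p))\<^sup>2"
      by (intro tendsto_intros p)
    show "(\<lambda>n. d + 1 / Suc n) \<longlonglongrightarrow> d"
      using tendsto_add[OF tendsto_const LIMSEQ_inverse_real_of_nat, of d]
      by (simp add: inverse_eq_divide)
    show "\<exists>N. \<forall>n\<ge>N. (norm (x - f n))\<^sup>2 \<le> d + 1 / Suc n"
      using f(2) less_imp_le by blast
  qed
  then have min: "(norm (x - p))\<^sup>2 \<le> (norm (x - s))\<^sup>2" if "s \<in> S" for s
    using d_le[OF that] by linarith
  have "(x - p) \<bullet> s = 0" if "s \<in> S" for s
  proof (cases "s = 0")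
    case False
    \<comment> \<open>\<open>t\<close> minimizes the quadratic
      \<open>norm ((x - p) - t *\<^sub>R s)\<close> squared, whose minimum falls short of its value
      at 0 by \<open>c\<^sup>2 / (s \<bullet> s)\<close>.\<close>
    define c where "c = (x - p) \<bullet> s"
    define t where "t = c / (s \<bullet> s)"
    have "p + t *\<^sub>R s \<in> S"
      using pS that assms(2) by (intro subspace_scale subspace_add)
    then have "(norm (x - p))\<^sup>2 \<le> (norm ((x - p) - t *\<^sub>R s))\<^sup>2"
      using min by (metis diff_diff_add)
    also have "\<dots> = (norm (x - p))\<^sup>2 - 2 * t * c + t * t * (s \<bullet> s)"
      unfolding power2_norm_eq_inner c_def by (simp add: inner_diff inner_commute)
    also have "\<dots> = (norm (x - p))\<^sup>2 - c\<^sup>2 / (s \<bullet> s)"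
      using False by (simp add: t_def power2_eq_square field_simps)
    finally have "c\<^sup>2 / (s \<bullet> s) \<le> 0" by simp
    moreover have "0 < s \<bullet> s" using False by simp
    ultimately have "c\<^sup>2 \<le> 0" by (simp only: pos_divide_le_eq mult_zero_left)
    then have "c = 0" by simp
    then show ?thesis by (simp add: c_def)
  qed simp
  then show thesis using that pS by blast
qed

lemma subspace_closure:
  fixes S :: "'a::real_normed_vector set"
  assumes "subspace S"
  shows "subspace (closure S)"
proof (rule subspaceI)
  show "0 \<in> closure S"
    using subspace_0[OF assms] closure_subset by blast
next
  fix x y assume "x \<in> closure S" "y \<in> closure S"
  then obtain f g where "\<And>n. f n \<in> S" "f \<longlonglongrightarrow> x" "\<And>n. g n \<in> S" "g \<longlonglongrightarrow> y"
    unfolding closure_sequential by blast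
  then show "x + y \<in> closure S"
    unfolding closure_sequential
    by (intro exI[of _ "\<lambda>n. f n + g n"]) (auto intro: tendsto_add subspace_add assms)
next
  fix c :: real and x assume "x \<in> closure S"
  then obtain f where "\<And>n. f n \<in> S" "f \<longlonglongrightarrow> x"
    unfolding closure_sequential by blast
  then show "c *\<^sub>R x \<in> closure S"
    unfolding closure_sequential
    by (intro exI[of _ "\<lambda>n. c *\<^sub>R f n"])
      (auto intro: tendsto_scaleR tendsto_const subspace_scale assms)
qed

text \<open>The residual of projecting any vector onto the closed span is orthogonal to
  \<open>M\<close>, hence zero.\<close>

lemma closure_span_eq_UNIV:
  fixes M :: "'a::{real_inner,banach} set"
  assumes "\<And>z. (\<And>m. m \<in> M \<Longrightarrow> z \<bullet> m = 0) \<Longrightarrow> z = 0"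
  shows "closure (span M) = UNIV"
proof -
  have "x \<in> closure (span M)" for x
  proof -
    obtain p where p: "p \<in> closure (span M)" "\<And>s. s \<in> closure (span M) \<Longrightarrow> (x - p) \<bullet> s = 0"
      using orthogonal_projection_exists[OF closed_closure subspace_closure[OF subspace_span]]
      by blast
    have "x - p = 0"
      using p(2) closure_subset span_base by (intro assms) blast
    then show ?thesis using p(1) by simp
  qed
  then show ?thesis by auto
qed

text \<open>Zorn's lemma gives a maximal orthonormal set; a nonzero vector orthogonal to it could be
  normalized and added.\<close>

lemma orthonormal_basis_exists: "\<exists>B :: 'a::{real_inner,banach} set. orthonormal_basis B"
proof -
  define \<A> :: "'a set set" where "\<A> = {B. pairwise orthogonal B \<and> (\<forall>e\<in>B. norm e = 1)}"
  have "\<exists>M\<in>\<A>. \<forall>X\<in>\<A>. M \<subseteq> X \<longrightarrow> X = M"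
  proof (rule subset_Zorn')
    fix C assume C: "subset.chain \<A> C"
    have "pairwise orthogonal (\<Union>C)"
    proof (rule pairwise_chain_Union)
      show "pairwise orthogonal S" if "S \<in> C" for S
        using C that by (auto simp: \<A>_def subset.chain_def)
      show "chain\<^sub>\<subseteq> C"
        using C unfolding chain_subset_def subset.chain_def by blast
    qed
    then show "\<Union>C \<in> \<A>"
      using C by (auto simp: \<A>_def subset.chain_def)
  qed
  then obtain B where B: "B \<in> \<A>" and max: "\<And>X. X \<in> \<A> \<Longrightarrow> B \<subseteq> X \<Longrightarrow> X = B" by blast
  have "closure (span B) = UNIV"
  proof (rule closure_span_eq_UNIV, rule ccontr)
    fix z assume z: "\<And>m. m \<in> B \<Longrightarrow> z \<bullet> m = 0" and "z \<noteq> 0"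
    have "insert (sgn z) B \<in> \<A>"
      using B z \<open>z \<noteq> 0\<close>
      by (auto simp: \<A>_def pairwise_insert orthogonal_def norm_sgn sgn_div_norm inner_commute)
    then have "sgn z \<in> B" using max by blast
    then have "z \<bullet> sgn z = 0" by (rule z)
    with \<open>z \<noteq> 0\<close> show False by (simp add: sgn_div_norm)
  qed
  with B show ?thesis by (auto simp: \<A>_def orthonormal_basis_def)
qed

text \<open>Distinct basis vectors are sqrt 2 apart, so balls of radius 1/2 around them are
  disjoint, and a second-countable space has room for only countably many.\<close>

lemma orthonormal_basis_countable:
  fixes B :: "'a::{real_inner,banach,second_countable_topology} set"
  assumes "orthonormal_basis B"
  shows "countable B"
proof (rule countable_image_inj_on)
  have far: "1 < dist e e'" if "e \<in> B" "e' \<in> B" "e \<noteq> e'" for e e'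
  proof -
    have "e \<bullet> e' = 0" "e \<bullet> e = 1" "e' \<bullet> e' = 1"
      using assms that
      by (auto simp: orthonormal_basis_def pairwise_def orthogonal_def norm_eq_1)
    then have "(dist e e')\<^sup>2 = 2"
      unfolding dist_norm power2_norm_eq_inner by (simp add: inner_diff inner_commute)
    then have "1\<^sup>2 < (dist e e')\<^sup>2" by simp
    then show ?thesis by (rule power_less_imp_less_base) simp
  qed
  have disj: "disjnt (ball e (1/2)) (ball e' (1/2))" if "e \<in> B" "e' \<in> B" "e \<noteq> e'" for e e'
    using far[OF that] by (auto simp: disjnt_iff) metric
  show "countable ((\<lambda>e. ball e (1/2)) ` B)"
    using disj by (intro countable_disjoint_open_subsets) (auto simp: pairwise_def)
  show "inj_on (\<lambda>e. ball e (1/2)) B"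
    using disj by (intro inj_onI) (metis centre_in_ball disjnt_iff half_gt_zero zero_less_one)
qed

section \<open>Riesz representation and adjoints\<close>

text \<open>A vector \<open>z\<close> orthogonal to the null space \<open>K\<close> represents
  \<open>f\<close> up to scaling, because \<open>x - (f x / f z) *\<^sub>R z\<close> lies in
  \<open>K\<close>.\<close>

lemma Riesz_representation:
  fixes f :: "'a::{real_inner,banach} \<Rightarrow> real"
  assumes "bounded_linear f"
  obtains v where "\<And>x. f x = x \<bullet> v"
proof (cases "\<forall>x. f x = 0")
  case True
  then show thesis using that[of 0] by simp
next
  case False
  then obtain x0 where x0: "f x0 \<noteq> 0" by blast
  interpret bounded_linear f by fact
  define K where "K = {x. f x = 0}"
  have "closed K"
    unfolding K_def by (intro closed_Collect_eq continuous_on continuous_on_id continuous_on_const)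
  moreover have "subspace K"
    by (auto simp: K_def subspace_def add scaleR zero)
  ultimately obtain p where p: "p \<in> K" "\<And>s. s \<in> K \<Longrightarrow> (x0 - p) \<bullet> s = 0"
    using orthogonal_projection_exists[of K x0] by blast
  define z where "z = x0 - p"
  have fz: "f z \<noteq> 0" using x0 p(1) by (simp add: z_def diff K_def)
  then have z0: "z \<noteq> 0" using zero by auto
  have "f x = x \<bullet> ((f z / (z \<bullet> z)) *\<^sub>R z)" for x
  proof -
    have "x - (f x / f z) *\<^sub>R z \<in> K"
      using fz by (simp add: K_def diff scaleR)
    then have "z \<bullet> (x - (f x / f z) *\<^sub>R z) = 0"
      unfolding z_def by (rule p(2))
    then show ?thesis
      using fz z0 by (simp add: inner_diff inner_commute field_simps)
  qed
  then show thesis by (rule that)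
qed

text \<open>\<open>adjoint\<close> is a choice; Riesz representation of
  \<open>\<lambda>x. A x \<bullet> y\<close>, for each \<open>y\<close>, shows that something
  satisfies the chosen property.\<close>

lemma adjoint_works:
  fixes A :: "'a::{real_inner,banach} \<Rightarrow> 'b::real_inner"
  assumes "bounded_linear A"
  shows "A x \<bullet> y = x \<bullet> adjoint A y"
proof -
  have "\<exists>v. \<forall>x. A x \<bullet> y = x \<bullet> v" for y
    using Riesz_representation[OF bounded_linear_compose[OF bounded_linear_inner_left assms]]
    by metis
  then have "\<exists>A'. \<forall>x y. A x \<bullet> y = x \<bullet> A' y" by metis
  then show ?thesis
    unfolding adjoint_def by (rule someI2_ex) blast
qed

text \<open>Nondegeneracy of the inner product gives linearity. Testing the relation at
  \<open>x = A' y\<close> transfers the bound of \<open>A\<close> to \<open>A'\<close>.\<close>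

lemma bounded_linear_of_adjoint_pair:
  fixes A :: "'a::real_inner \<Rightarrow> 'b::real_inner" and A' :: "'b \<Rightarrow> 'a"
  assumes A: "bounded_linear A" and adj: "\<And>x y. A x \<bullet> y = x \<bullet> A' y"
  shows "bounded_linear A'"
proof -
  obtain K where "0 < K" and K: "\<And>x. norm (A x) \<le> norm x * K"
    using bounded_linear.pos_bounded[OF A] by blast
  show ?thesis
  proof (rule bounded_linear_intro)
    show "A' (y + z) = A' y + A' z" for y z
      by (rule vector_eq_ldot[THEN iffD1]) (simp add: adj[symmetric] inner_add_right)
    show "A' (c *\<^sub>R y) = c *\<^sub>R A' y" for c y
      by (rule vector_eq_ldot[THEN iffD1]) (simp add: adj[symmetric])
    show "norm (A' y) \<le> norm y * K" for y
    proof (cases "A' y = 0")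
      case True
      then show ?thesis using \<open>0 < K\<close> by simp
    next
      case False
      have "norm (A' y) * norm (A' y) = A (A' y) \<bullet> y"
        by (simp add: adj power2_norm_eq_inner flip: power2_eq_square)
      also have "\<dots> \<le> norm (A (A' y)) * norm y" by (rule norm_cauchy_schwarz)
      also have "\<dots> \<le> (norm (A' y) * K) * norm y" by (intro mult_right_mono K) simp
      finally show ?thesis using False by (simp add: ac_simps)
    qed
  qed
qed

section \<open>Boundedness by Baire category\<close>

text \<open>The closed sublevel sets at integer heights cover the space, so one of them contains a
  ball; homogeneity and the triangle inequality move that ball to the origin.\<close>

lemma lsc_seminorm_bounded:
  fixes p :: "'a::banach \<Rightarrow> real"
  assumes tri: "\<And>x y. p (x + y) \<le> p x + p y"
    and hom: "\<And>c x. p (c *\<^sub>R x) = \<bar>c\<bar> * p x"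
    and lsc: "\<And>c. closed {x. p x \<le> c}"
  shows "\<exists>K. \<forall>x. p x \<le> K * norm x"
proof -
  define G where "G = range (\<lambda>n::nat. {x. p x \<le> real n})"
  have "\<exists>n. x \<in> {x. p x \<le> real n}" for x
    using real_arch_simple by auto
  then have "\<Union>G = UNIV" by (auto simp: G_def)
  have "\<exists>n::nat. interior {x. p x \<le> real n} \<noteq> {}"
  proof (rule ccontr)
    assume "\<not> ?thesis"
    then have "euclidean interior_of (\<Union>G) = {}"
      using lsc
      by (intro Baire_category_alt disjI1 completely_metrizable_space_euclidean)
        (auto simp: G_def interior_of_eq_empty)
    then show False using \<open>\<Union>G = UNIV\<close> by simp
  qed
  then obtain n :: nat and a where "a \<in> interior {x. p x \<le> real n}" by blast
  then obtain e where e: "0 < e" "cball a e \<subseteq> {x. p x \<le> real n}"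
    by (meson interior_subset open_contains_cball open_interior subset_trans)
  have p0: "p 0 = 0" using hom[of 0 0] by simp
  have "p x \<le> (2 * real n / e) * norm x" for x
  proof (cases "x = 0")
    case False
    \<comment> \<open>Rescaling puts \<open>a + u\<close> on the boundary of the ball. Subtracting
      the centre costs another \<open>p a \<le> n\<close>, whence the factor 2.\<close>
    define u where "u = (e / norm x) *\<^sub>R x"
    have "norm u = e" using False e(1) by (simp add: u_def)
    then have "p (a + u) \<le> n" "p a \<le> n"
      using e by (auto simp: subset_iff dist_norm)
    moreover have "p u \<le> p (a + u) + p ((-1) *\<^sub>R a)"
      using tri[of "a + u" "(-1) *\<^sub>R a"] by simp
    ultimately have "p u \<le> 2 * n" unfolding hom by simp
    then show ?thesis
      using False e(1) unfolding u_def hom by (simp add: field_simps)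
  qed (simp add: p0)
  then show ?thesis by blast
qed

section \<open>Trace of a covariance operator composed with a bounded operator\<close>

text \<open>The Fourier sum \<open>p\<close> is the orthogonal projection onto
  \<open>span F\<close>; Pythagoras applies to \<open>x - s = (x - p) + (p - s)\<close>.\<close>

lemma finite_orthonormal_best_approx:
  fixes F :: "'a::real_inner set"
  assumes F: "finite F" "pairwise orthogonal F" "\<And>e. e \<in> F \<Longrightarrow> norm e = 1"
    and s: "s \<in> span F"
  shows "norm (x - (\<Sum>e\<in>F. (x \<bullet> e) *\<^sub>R e)) \<le> norm (x - s)"
proof -
  define p where "p = (\<Sum>e\<in>F. (x \<bullet> e) *\<^sub>R e)"
  have "orthogonal (x - p) e" if "e \<in> F" for e
  proof -
    have "p \<bullet> e = (\<Sum>e'\<in>F. (x \<bullet> e') * (e' \<bullet> e))"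
      by (simp add: p_def inner_sum_left)
    also have "\<dots> = (\<Sum>e'\<in>{e}. (x \<bullet> e') * (e' \<bullet> e))"
      using F that by (intro sum.mono_neutral_right) (auto simp: pairwise_def orthogonal_def)
    also have "\<dots> = x \<bullet> e"
      using F(3)[OF that] by (simp add: norm_eq_1)
    finally show ?thesis by (simp add: orthogonal_def inner_diff_left)
  qed
  moreover have "p - s \<in> span F"
    unfolding p_def by (intro span_diff[OF _ s] span_sum span_scale span_base)
  ultimately have "orthogonal (x - p) (p - s)"
    using orthogonal_to_span by blast
  then have "(norm ((x - p) + (p - s)))\<^sup>2 = (norm (x - p))\<^sup>2 + (norm (p - s))\<^sup>2"
    by (rule norm_add_Pythagorean)
  then have "(norm (x - p))\<^sup>2 \<le> (norm (x - s))\<^sup>2" by simp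
  then show ?thesis unfolding p_def by (rule power2_le_imp_le) simp
qed

text \<open>Ensures that \<open>cov_op\<close> is a genuine Bochner integral and not the default
  value 0.\<close>

lemma cov_op_integrable:
  fixes \<phi> :: "'a \<Rightarrow> 'h::{real_inner,banach,second_countable_topology}"
  assumes "finite_measure R" and "\<phi> \<in> borel_measurable R" and bnd: "\<And>x. norm (\<phi> x) \<le> b"
  shows "integrable R (\<lambda>x. rank_one (\<phi> x) (\<phi> x) f)"
proof (rule finite_measure.integrable_const_bound[OF assms(1)])
  show "AE x in R. norm (rank_one (\<phi> x) (\<phi> x) f) \<le> b * norm f * b"
  proof (rule AE_I2)
    fix x
    have "\<bar>\<phi> x \<bullet> f\<bar> \<le> norm (\<phi> x) * norm f" by (rule Cauchy_Schwarz_ineq2)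
    also have "\<dots> \<le> b * norm f" by (intro mult_right_mono bnd) simp
    finally show "norm (rank_one (\<phi> x) (\<phi> x) f) \<le> b * norm f * b"
      unfolding rank_one_def norm_scaleR
      by (intro mult_mono bnd) (auto intro: order_trans[OF abs_ge_zero])
  qed
qed (use assms(2) in \<open>simp add: rank_one_def\<close>)

text \<open>A finite partial sum of the trace is the integral of
  \<open>proj F (\<phi> x) \<bullet> D (\<phi> x)\<close>, so its error is governed by the
  integrated distance from \<open>\<phi> x\<close> to \<open>span F\<close>. Dominated convergence
  makes this small along one exhausting sequence of finite sets, and best approximation carries the
  estimate to every larger finite set.\<close>

lemma has_trace_cov_op:
  fixes \<phi> :: "'a \<Rightarrow> 'h::{real_inner,banach,second_countable_topology}"
  assumes R: "finite_measure R" and \<phi>: "\<phi> \<in> borel_measurable R"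
    and bnd: "\<And>x. norm (\<phi> x) \<le> b" and D: "bounded_linear D"
  shows "has_trace (D \<circ> cov_op R \<phi>) (\<integral>x. \<phi> x \<bullet> D (\<phi> x) \<partial>R)"
  unfolding has_trace_def has_sum_def tendsto_iff
proof (intro allI impI)
  fix B :: "'h set" and \<epsilon> :: real
  assume B: "orthonormal_basis B" and "0 < \<epsilon>"
  interpret finite_measure R by fact
  interpret D: bounded_linear D by fact
  obtain K where K: "0 < K" "\<And>u. norm (D u) \<le> norm u * K"
    using D.pos_bounded by blast
  have D\<phi>: "(\<lambda>x. D (\<phi> x)) \<in> borel_measurable R"
    using measurable_compose[OF \<phi> borel_measurable_continuous_onI[OF D.continuous_on[OF continuous_on_id]]] .
  have D\<phi>_le: "norm (D (\<phi> x)) \<le> b * K" for x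
    using K(2)[of "\<phi> x"] mult_right_mono[OF bnd[of x], of K] K(1) by linarith
  have b0: "0 \<le> b" using bnd norm_ge_zero order_trans by blast
  define proj where "proj F u = (\<Sum>e\<in>F. (u \<bullet> e) *\<^sub>R e)" for F :: "'h set" and u
  have best: "norm (u - proj F u) \<le> norm (u - s)"
    if "finite F" "F \<subseteq> B" "s \<in> span F" for F u s
    unfolding proj_def using B that
    by (intro finite_orthonormal_best_approx)
      (auto simp: orthonormal_basis_def intro: pairwise_subset)
  have proj_meas [measurable]: "(\<lambda>x. proj F (\<phi> x)) \<in> borel_measurable R" for F
    unfolding proj_def using \<phi> by measurable
  have tail_le: "norm (\<phi> x - proj F (\<phi> x)) \<le> b" if "finite F" "F \<subseteq> B" for F x
    using best[OF that span_zero, of "\<phi> x"] bnd[of x] by simp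
  have tail_int: "integrable R (\<lambda>x. norm (\<phi> x - proj F (\<phi> x)))" if "finite F" "F \<subseteq> B" for F
    using tail_le[OF that] \<phi> by (intro integrable_const_bound[where B = b]) auto
  have D\<phi>_int: "integrable R (\<lambda>x. \<phi> x \<bullet> D (\<phi> x))"
  proof (rule integrable_const_bound[where B = "b * (b * K)"])
    show "AE x in R. norm (\<phi> x \<bullet> D (\<phi> x)) \<le> b * (b * K)"
      unfolding real_norm_def
      by (intro AE_I2 order_trans[OF Cauchy_Schwarz_ineq2 mult_mono[OF bnd D\<phi>_le b0 norm_ge_zero]])
  qed (use \<phi> D\<phi> in measurable)
  have proj_int: "integrable R (\<lambda>x. proj F (\<phi> x) \<bullet> D (\<phi> x))"
    and sum_eq: "(\<Sum>e\<in>F. e \<bullet> (D \<circ> cov_op R \<phi>) e) = (\<integral>x. proj F (\<phi> x) \<bullet> D (\<phi> x) \<partial>R)" for F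
  proof -
    have int: "integrable R (\<lambda>x. e \<bullet> D (rank_one (\<phi> x) (\<phi> x) e))" for e
      by (intro integrable_inner_right integrable_bounded_linear[OF D] cov_op_integrable[OF R \<phi> bnd])
    \<comment> \<open>Both sides equal the sum of the products of
      \<open>\<phi> x \<bullet> e\<close> with \<open>e \<bullet> D (\<phi> x)\<close>.\<close>
    have eq: "proj F (\<phi> x) \<bullet> D (\<phi> x) = (\<Sum>e\<in>F. e \<bullet> D (rank_one (\<phi> x) (\<phi> x) e))" for x
      by (simp add: proj_def rank_one_def inner_sum_left D.scaleR)
    show "integrable R (\<lambda>x. proj F (\<phi> x) \<bullet> D (\<phi> x))"
      unfolding eq using int by (intro Bochner_Integration.integrable_sum)
    have "e \<bullet> (D \<circ> cov_op R \<phi>) e = (\<integral>x. e \<bullet> D (rank_one (\<phi> x) (\<phi> x) e) \<partial>R)" for e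
    proof -
      have "(\<integral>x. e \<bullet> D (rank_one (\<phi> x) (\<phi> x) e) \<partial>R) = e \<bullet> (\<integral>x. D (rank_one (\<phi> x) (\<phi> x) e) \<partial>R)"
        by (intro integral_inner_right integrable_bounded_linear[OF D]
            cov_op_integrable[OF R \<phi> bnd])
      also have "\<dots> = e \<bullet> D (cov_op R \<phi> e)"
        unfolding cov_op_def
        by (subst integral_bounded_linear[OF D cov_op_integrable[OF R \<phi> bnd]]) simp
      finally show ?thesis by simp
    qed
    then show "(\<Sum>e\<in>F. e \<bullet> (D \<circ> cov_op R \<phi>) e) = (\<integral>x. proj F (\<phi> x) \<bullet> D (\<phi> x) \<partial>R)"
      unfolding eq using int by (simp add: Bochner_Integration.integral_sum)
  qed
  \<comment> \<open>Dominated convergence needs a sequence, whereas \<open>has_sum\<close> is a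
    limit over the net of finite subsets. The sets \<open>Fn n\<close> below are cofinal in that
    net.\<close>
  obtain enum :: "nat \<Rightarrow> 'h" where enum: "B \<subseteq> range enum"
  proof (cases "B = {}")
    case False
    then show thesis
      using that[of "from_nat_into B"] range_from_nat_into[OF False orthonormal_basis_countable[OF B]]
      by simp
  qed (use that in auto)
  define Fn where "Fn n = B \<inter> enum ` {..n}" for n
  have Fn: "finite (Fn n)" "Fn n \<subseteq> B" for n by (auto simp: Fn_def)
  have Fn_ev: "\<exists>N. \<forall>n\<ge>N. F \<subseteq> Fn n" if F: "finite F" "F \<subseteq> B" for F
  proof -
    have "\<exists>J. finite J \<and> F = enum ` J"
      using finite_subset_image[OF F(1), of enum UNIV] F(2) enum by auto
    then obtain J where J: "finite J" "F = enum ` J" by blast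
    then obtain N where "J \<subseteq> {..N}" using finite_nat_set_iff_bounded_le by auto
    then have "F \<subseteq> Fn n" if "N \<le> n" for n
      using J(2) F(2) that by (fastforce simp: Fn_def)
    then show ?thesis by blast
  qed
  have tail_0: "(\<lambda>n. norm (u - proj (Fn n) u)) \<longlonglongrightarrow> 0" for u
  proof (rule LIMSEQ_I)
    fix r :: real assume "0 < r"
    have "u \<in> closure (span B)" using B by (simp add: orthonormal_basis_def)
    then obtain s where s: "s \<in> span B" "dist s u < r"
      using \<open>0 < r\<close> closure_approachable by blast
    then obtain F c where F: "finite F" "F \<subseteq> B" "s = (\<Sum>a\<in>F. c a *\<^sub>R a)"
      unfolding span_explicit by blast
    then have "s \<in> span F" by (auto intro: span_sum span_scale span_base)
    then obtain N where "\<And>n. N \<le> n \<Longrightarrow> s \<in> span (Fn n)"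
      using Fn_ev[OF F(1,2)] span_mono by (metis subsetD)
    then have "norm (u - proj (Fn n) u) < r" if "N \<le> n" for n
      using best[OF Fn, of s n u] s(2) that by (fastforce simp: dist_norm norm_minus_commute)
    then show "\<exists>N. \<forall>n\<ge>N. norm (norm (u - proj (Fn n) u) - 0) < r" by auto
  qed
  have "(\<lambda>n. \<integral>x. norm (\<phi> x - proj (Fn n) (\<phi> x)) \<partial>R) \<longlonglongrightarrow> (\<integral>x. 0 \<partial>R)"
  proof (rule integral_dominated_convergence[where w = "\<lambda>_. b"])
    show "AE x in R. (\<lambda>n. norm (\<phi> x - proj (Fn n) (\<phi> x))) \<longlonglongrightarrow> 0"
      using tail_0 by simp
    show "AE x in R. norm (norm (\<phi> x - proj (Fn n) (\<phi> x))) \<le> b" for n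
      using tail_le[OF Fn] by simp
  qed (use \<phi> in \<open>auto\<close>)
  \<comment> \<open>The summand 1 keeps the denominator positive when \<open>b = 0\<close>.\<close>
  then have "\<forall>\<^sub>F n in sequentially. (\<integral>x. norm (\<phi> x - proj (Fn n) (\<phi> x)) \<partial>R) < \<epsilon> / (b * K + 1)"
    using \<open>0 < \<epsilon>\<close> b0 K(1) by (intro order_tendstoD(2)) (auto intro!: divide_pos_pos add_nonneg_pos)
  then obtain n where n: "(\<integral>x. norm (\<phi> x - proj (Fn n) (\<phi> x)) \<partial>R) < \<epsilon> / (b * K + 1)"
    by (auto simp: eventually_sequentially)
  have "dist (\<Sum>e\<in>F. e \<bullet> (D \<circ> cov_op R \<phi>) e) (\<integral>x. \<phi> x \<bullet> D (\<phi> x) \<partial>R) < \<epsilon>"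
    if F: "finite F" "Fn n \<subseteq> F" "F \<subseteq> B" for F
  proof -
    have ptw: "norm (proj F (\<phi> x) \<bullet> D (\<phi> x) - \<phi> x \<bullet> D (\<phi> x))
        \<le> (b * K + 1) * norm (\<phi> x - proj (Fn n) (\<phi> x))" for x
    proof -
      \<comment> \<open>The projection onto the smaller set competes in the approximation over
        \<open>F\<close>, which makes the bound uniform in \<open>F\<close>.\<close>
      have "proj (Fn n) (\<phi> x) \<in> span F"
        unfolding proj_def using F(2) by (intro span_sum span_scale span_base) auto
      then have "norm (\<phi> x - proj F (\<phi> x)) \<le> norm (\<phi> x - proj (Fn n) (\<phi> x))"
        by (rule best[OF F(1,3)])
      then have "norm (\<phi> x - proj F (\<phi> x)) * norm (D (\<phi> x))
          \<le> norm (\<phi> x - proj (Fn n) (\<phi> x)) * (b * K + 1)"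
        using D\<phi>_le[of x] by (intro mult_mono) auto
      moreover have "norm ((proj F (\<phi> x) - \<phi> x) \<bullet> D (\<phi> x)) \<le> norm (\<phi> x - proj F (\<phi> x)) * norm (D (\<phi> x))"
        using Cauchy_Schwarz_ineq2[of "proj F (\<phi> x) - \<phi> x"] by (simp add: norm_minus_commute)
      ultimately show ?thesis by (simp add: inner_diff_left mult.commute)
    qed
    have "dist (\<Sum>e\<in>F. e \<bullet> (D \<circ> cov_op R \<phi>) e) (\<integral>x. \<phi> x \<bullet> D (\<phi> x) \<partial>R)
        = norm (\<integral>x. proj F (\<phi> x) \<bullet> D (\<phi> x) - \<phi> x \<bullet> D (\<phi> x) \<partial>R)"
      unfolding sum_eq dist_norm
      by (subst Bochner_Integration.integral_diff[OF proj_int D\<phi>_int]) simp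
    also have "\<dots> \<le> (\<integral>x. (b * K + 1) * norm (\<phi> x - proj (Fn n) (\<phi> x)) \<partial>R)"
    proof (rule order_trans[OF integral_norm_bound], rule integral_mono)
      show "integrable R (\<lambda>x. norm (proj F (\<phi> x) \<bullet> D (\<phi> x) - \<phi> x \<bullet> D (\<phi> x)))"
        by (intro integrable_norm Bochner_Integration.integrable_diff proj_int D\<phi>_int)
      show "integrable R (\<lambda>x. (b * K + 1) * norm (\<phi> x - proj (Fn n) (\<phi> x)))"
        by (intro integrable_mult_right tail_int Fn)
    qed (rule ptw)
    also have "\<dots> = (b * K + 1) * (\<integral>x. norm (\<phi> x - proj (Fn n) (\<phi> x)) \<partial>R)"
      by simp
    also have "\<dots> < \<epsilon>"
      using n b0 K(1) by (simp add: pos_less_divide_eq add_nonneg_pos mult.commute)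
    finally show ?thesis .
  qed
  then show "\<forall>\<^sub>F F in finite_subsets_at_top B.
      dist (\<Sum>e\<in>F. e \<bullet> (D \<circ> cov_op R \<phi>) e) (\<integral>x. \<phi> x \<bullet> D (\<phi> x) \<partial>R) < \<epsilon>"
    unfolding eventually_finite_subsets_at_top using Fn by (intro exI[of _ "Fn n"]) simp
qed

text \<open>Uniqueness rests on the existence of an orthonormal basis; otherwise
  \<open>has_trace A t\<close> would hold vacuously for every \<open>t\<close>.\<close>

lemma op_trace_eqI:
  fixes A :: "'h::{real_inner,banach} \<Rightarrow> 'h"
  assumes "has_trace A t"
  shows "op_trace A = t"
  unfolding op_trace_def
proof (rule the_equality)
  fix t' assume "has_trace A t'"
  with assms show "t' = t"
    using orthonormal_basis_exists[where 'a = 'h] has_sum_unique unfolding has_trace_def by blast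
qed fact

section \<open>Features and conditional mean operators\<close>

context rkhs
begin

lemma rkhs_elem_eqI:
  assumes "\<And>x. x \<in> S \<Longrightarrow> evh f x = u x"
  shows "rkhs_elem S evh u = f"
  unfolding rkhs_elem_def using assms by (intro the_equality) (auto intro: ev_inject)

text \<open>The locale only postulates some representer of evaluation; \<open>ev_inject\<close>
  identifies it with the description in \<open>canonical_feature\<close>.\<close>

lemma
  assumes "x \<in> S"
  shows ev_eq_inner: "evh f x = f \<bullet> canonical_feature S k evh x"
    and ev_feature: "x' \<in> S \<Longrightarrow> evh (canonical_feature S k evh x) x' = k x' x"
proof -
  obtain \<phi> where \<phi>: "\<And>x'. x' \<in> S \<Longrightarrow> evh \<phi> x' = k x' x" "\<And>f. evh f x = f \<bullet> \<phi>"
    using reproducing[OF assms] by blast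
  have "canonical_feature S k evh x = \<phi>"
    unfolding canonical_feature_def by (rule rkhs_elem_eqI) (rule \<phi>(1))
  with \<phi> show "evh f x = f \<bullet> canonical_feature S k evh x"
    and "x' \<in> S \<Longrightarrow> evh (canonical_feature S k evh x) x' = k x' x" by simp_all
qed

lemma inner_feature:
  assumes "x \<in> S" "x' \<in> S"
  shows "canonical_feature S k evh x \<bullet> canonical_feature S k evh x' = k x x'"
  using ev_eq_inner[OF assms(1)] ev_feature[OF assms(2,1)] by (metis inner_commute)

lemma norm_feature: "x \<in> S \<Longrightarrow> norm (canonical_feature S k evh x) = sqrt (k x x)"
  by (simp add: norm_eq_sqrt_inner inner_feature)

text \<open>A vector orthogonal to all features vanishes as a function on \<open>S\<close>, so it is
  zero.\<close>

lemma span_feature_dense: "closure (span (canonical_feature S k evh ` S)) = UNIV"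
proof (rule closure_span_eq_UNIV)
  fix z assume "\<And>m. m \<in> canonical_feature S k evh ` S \<Longrightarrow> z \<bullet> m = 0"
  then have "evh z x = evh 0 x" if "x \<in> S" for x
    using that by (simp add: ev_eq_inner)
  then show "z = 0" by (rule ev_inject)
qed

text \<open>No bound on the kernel is available here, only integrability of each function. Norm
  convergence implies pointwise convergence, so Fatou's lemma applies to absolute values; this is
  why \<open>p\<close> integrates \<open>\<bar>evh g y\<bar>\<close>.\<close>

lemma bounded_linear_integral_ev:
  assumes sp: "space \<nu> = S" and int: "\<And>g. integrable \<nu> (evh g)"
  shows "bounded_linear (\<lambda>g. \<integral>y. evh g y \<partial>\<nu>)"
proof -
  define p where "p g = (\<integral>y. \<bar>evh g y\<bar> \<partial>\<nu>)" for g
  have abs_int: "integrable \<nu> (\<lambda>y. \<bar>evh g y\<bar>)" for g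
    using int by (rule integrable_abs)
  have "\<exists>K. \<forall>g. p g \<le> K * norm g"
  proof (rule lsc_seminorm_bounded)
    show "p (f + g) \<le> p f + p g" for f g
    proof -
      have "p (f + g) \<le> (\<integral>y. \<bar>evh f y\<bar> + \<bar>evh g y\<bar> \<partial>\<nu>)"
        unfolding p_def using abs_int sp by (intro integral_mono) (auto simp: ev_add)
      also have "\<dots> = p f + p g"
        unfolding p_def using abs_int by simp
      finally show ?thesis .
    qed
    show "p (c *\<^sub>R g) = \<bar>c\<bar> * p g" for c g
    proof -
      have "p (c *\<^sub>R g) = (\<integral>y. \<bar>c\<bar> * \<bar>evh g y\<bar> \<partial>\<nu>)"
        unfolding p_def using sp
        by (intro Bochner_Integration.integral_cong) (auto simp: ev_scaleR abs_mult)
      then show ?thesis by (simp add: p_def)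
    qed
    show "closed {g. p g \<le> c}" for c
    proof (unfold closed_sequential_limits, intro allI impI, elim conjE)
      fix f :: "nat \<Rightarrow> 'h" and g
      assume f: "\<forall>n. f n \<in> {g. p g \<le> c}" and lim: "f \<longlonglongrightarrow> g"
      have nn: "(\<integral>\<^sup>+y. ennreal \<bar>evh g y\<bar> \<partial>\<nu>) = ennreal (p g)" for g
        unfolding p_def using abs_int by (intro nn_integral_eq_integral) auto
      have "(\<integral>\<^sup>+y. ennreal \<bar>evh g y\<bar> \<partial>\<nu>)
          = (\<integral>\<^sup>+y. liminf (\<lambda>n. ennreal \<bar>evh (f n) y\<bar>) \<partial>\<nu>)"
      proof (rule nn_integral_cong)
        fix y assume "y \<in> space \<nu>"
        then have "(\<lambda>n. ennreal \<bar>evh (f n) y\<bar>) \<longlonglongrightarrow> ennreal \<bar>evh g y\<bar>"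
          using sp lim by (auto simp: ev_eq_inner intro!: tendsto_intros)
        then show "ennreal \<bar>evh g y\<bar> = liminf (\<lambda>n. ennreal \<bar>evh (f n) y\<bar>)"
          by (rule lim_imp_Liminf[OF trivial_limit_sequentially, symmetric])
      qed
      also have "\<dots> \<le> liminf (\<lambda>n. \<integral>\<^sup>+y. ennreal \<bar>evh (f n) y\<bar> \<partial>\<nu>)"
        using abs_int by (intro nn_integral_liminf) auto
      also have "\<dots> \<le> ennreal c"
        unfolding nn using f by (intro Liminf_le) (auto intro!: always_eventually ennreal_leI)
      finally have "ennreal (p g) \<le> ennreal c" unfolding nn .
      \<comment> \<open>\<open>ennreal\<close> sends negative reals to 0, so the sign of
        \<open>c\<close> is needed to return to a real inequality.\<close>
      moreover have "0 \<le> c"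
      proof -
        have "0 \<le> p (f 0)" by (simp add: p_def)
        also have "\<dots> \<le> c" using f by simp
        finally show ?thesis .
      qed
      ultimately show "g \<in> {g. p g \<le> c}" by simp
    qed
  qed
  then obtain K where K: "\<And>g. p g \<le> K * norm g" by blast
  show ?thesis
  proof (rule bounded_linear_intro)
    fix f g c
    show "(\<integral>y. evh (f + g) y \<partial>\<nu>) = (\<integral>y. evh f y \<partial>\<nu>) + (\<integral>y. evh g y \<partial>\<nu>)"
      unfolding Bochner_Integration.integral_add[OF int int, symmetric] using sp
      by (intro Bochner_Integration.integral_cong) (auto simp: ev_add)
    show "(\<integral>y. evh (c *\<^sub>R g) y \<partial>\<nu>) = c *\<^sub>R (\<integral>y. evh g y \<partial>\<nu>)"
      unfolding integral_scaleR_right[symmetric] using sp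
      by (intro Bochner_Integration.integral_cong) (auto simp: ev_scaleR)
    show "norm (\<integral>y. evh g y \<partial>\<nu>) \<le> norm g * K"
      using K[of g] by (intro order_trans[OF integral_norm_bound]) (simp add: p_def mult.commute)
  qed
qed

end

text \<open>The squared distance between features is a continuous expression in \<open>k\<close>
  that vanishes on the diagonal. This later yields Borel measurability of the feature map.\<close>

lemma continuous_on_feature:
  fixes k :: "'x::topological_space \<Rightarrow> 'x \<Rightarrow> real"
    and evk :: "'hx::{real_inner,banach} \<Rightarrow> 'x \<Rightarrow> real"
  assumes "rkhs UNIV k evk" and cont: "continuous_on UNIV (\<lambda>(x, x'). k x x')"
  shows "continuous_on UNIV (canonical_feature UNIV k evk)"
proof -
  interpret rkhs UNIV k evk by fact
  let ?\<phi> = "canonical_feature UNIV k evk"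
  have k: "continuous_on UNIV (\<lambda>x. k (f x) (g x))"
    if "continuous_on UNIV f" "continuous_on UNIV g" for f g :: "'x \<Rightarrow> 'x"
    using continuous_on_compose2[OF cont continuous_on_Pair[OF that]] by simp
  have dist2: "dist (?\<phi> x) (?\<phi> x') = sqrt (k x x - 2 * k x x' + k x' x')" for x x'
    unfolding dist_norm norm_eq_sqrt_inner
    by (simp add: inner_diff inner_feature[symmetric] inner_commute)
  have "(?\<phi> \<longlongrightarrow> ?\<phi> x0) (at x0)" for x0
  proof (rule tendsto_dist_iff[THEN iffD2])
    have "continuous_on UNIV (\<lambda>x. dist (?\<phi> x) (?\<phi> x0))"
      unfolding dist2 by (intro continuous_intros k)
    then have "((\<lambda>x. dist (?\<phi> x) (?\<phi> x0)) \<longlongrightarrow> dist (?\<phi> x0) (?\<phi> x0)) (at x0)"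
      unfolding continuous_on_def by (rule bspec) simp
    then show "((\<lambda>x. dist (?\<phi> x) (?\<phi> x0)) \<longlongrightarrow> 0) (at x0)" by simp
  qed
  then show ?thesis by (simp add: continuous_on_def)
qed

section \<open>Conditional mean operators\<close>

text \<open>Treats a single Markov kernel, to be interpreted once for \<open>\<kappa>P\<close> and
  once for \<open>\<kappa>Q\<close>.\<close>

locale cond_mean = x: rkhs UNIV k evk + y: rkhs "space N" l evl
  for k :: "'x \<Rightarrow> 'x \<Rightarrow> real" and evk :: "'hx::{real_inner,banach} \<Rightarrow> 'x \<Rightarrow> real"
    and N :: "'y measure" and l :: "'y \<Rightarrow> 'y \<Rightarrow> real"
    and evl :: "'hy::{real_inner,banach} \<Rightarrow> 'y \<Rightarrow> real" +
  fixes \<kappa> :: "'x \<Rightarrow> 'y measure"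
  assumes space_kernel: "space (\<kappa> x) = space N"
    and integrable_ev: "integrable (\<kappa> x) (evl g)"
    and cond_exp_in_rkhs: "\<exists>f. evk f = (\<lambda>x. \<integral>y. evl g y \<partial>\<kappa> x)"
begin

abbreviation feat where "feat \<equiv> canonical_feature UNIV k evk"

lemma ev_cond_mean_op_adj: "evk (cond_mean_op_adj evk evl \<kappa> g) x = (\<integral>y. evl g y \<partial>\<kappa> x)"
proof -
  obtain f where f: "evk f = (\<lambda>x. \<integral>y. evl g y \<partial>\<kappa> x)" using cond_exp_in_rkhs by blast
  then have "cond_mean_op_adj evk evl \<kappa> g = f"
    unfolding cond_mean_op_adj_def by (intro x.rkhs_elem_eqI) simp
  then show ?thesis by (simp add: f)
qed

text \<open>Each evaluation of the image is a bounded functional by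
  \<open>bounded_linear_integral_ev\<close>; the Baire argument upgrades this to a bound on the
  operator.\<close>

lemma bounded_linear_cond_mean_op_adj: "bounded_linear (cond_mean_op_adj evk evl \<kappa>)"
proof -
  let ?A = "cond_mean_op_adj evk evl \<kappa>"
  have bl: "bounded_linear (\<lambda>g. evk (?A g) x)" for x
    unfolding ev_cond_mean_op_adj
    by (rule y.bounded_linear_integral_ev[OF space_kernel integrable_ev])
  have add: "?A (f + g) = ?A f + ?A g" for f g
    by (rule x.ev_inject) (simp add: x.ev_add linear_simps[OF bl])
  have scale: "?A (c *\<^sub>R g) = c *\<^sub>R ?A g" for c g
    by (rule x.ev_inject) (simp add: x.ev_scaleR linear_simps[OF bl])
  have "\<exists>K. \<forall>g. norm (?A g) \<le> K * norm g"
  proof (rule lsc_seminorm_bounded)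
    show "norm (?A (f + g)) \<le> norm (?A f) + norm (?A g)" for f g
      unfolding add by (rule norm_triangle_ineq)
    show "norm (?A (c *\<^sub>R g)) = \<bar>c\<bar> * norm (?A g)" for c g
      by (simp add: scale)
    \<comment> \<open>The norm of \<open>A g\<close> is a supremum over the span of the features, on which \<open>A\<close> is weakly
      continuous.\<close>
    show "closed {g. norm (?A g) \<le> c}" for c
    proof (cases "0 \<le> c")
      case True
      have "norm (?A g) \<le> c \<longleftrightarrow> (\<forall>h\<in>span (range feat). ?A g \<bullet> h \<le> c * norm h)" for g
      proof
        assume le: "norm (?A g) \<le> c"
        show "\<forall>h\<in>span (range feat). ?A g \<bullet> h \<le> c * norm h"
          by (intro ballI order_trans[OF norm_cauchy_schwarz mult_right_mono[OF le norm_ge_zero]])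
      next
        assume *: "\<forall>h\<in>span (range feat). ?A g \<bullet> h \<le> c * norm h"
        \<comment> \<open>By density the inequality holds for every \<open>h\<close>; taking
          \<open>h\<close> to be the image of \<open>g\<close> itself and cancelling one norm gives
          the bound, with \<open>0 \<le> c\<close> covering a zero image.\<close>
        have "closure (span (range feat)) \<subseteq> {h. ?A g \<bullet> h \<le> c * norm h}"
          using * by (intro closure_minimal closed_Collect_le continuous_intros) auto
        then have "?A g \<bullet> ?A g \<le> c * norm (?A g)"
          using x.span_feature_dense by auto
        then show "norm (?A g) \<le> c"
          using True by (cases "?A g = 0") (simp_all flip: power2_norm_eq_inner add: power2_eq_square)
      qed
      then have "{g. norm (?A g) \<le> c} = (\<Inter>h\<in>span (range feat). {g. ?A g \<bullet> h \<le> c * norm h})"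
        by auto
      moreover have "continuous_on UNIV (\<lambda>g. ?A g \<bullet> h)" if "h \<in> span (range feat)" for h
        using that
      proof (induction rule: span_induct_alt)
        case (step c h h')
        then obtain x where "h = feat x" by blast
        then have "continuous_on UNIV (\<lambda>g. ?A g \<bullet> h)"
          using linear_continuous_on[OF bl[of x]] by (simp add: x.ev_eq_inner)
        with step show ?case by (simp add: inner_add_right continuous_intros)
      qed simp
      ultimately show ?thesis
        by (auto intro!: closed_INT closed_Collect_le continuous_on_const)
    next
      case False
      then have "{g. norm (?A g) \<le> c} = {}"
        by (auto simp: not_le intro: less_le_trans[OF _ norm_ge_zero])
      then show ?thesis by simp
    qed
  qed
  then obtain K where K: "\<And>g. norm (?A g) \<le> K * norm g" by blast
  show ?thesis
    using K by (intro bounded_linear_intro[of _ K] add scale) (simp add: mult.commute)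
qed

lemma inner_cond_mean_op: "cond_mean_op_adj evk evl \<kappa> g \<bullet> h = g \<bullet> cond_mean_op evk evl \<kappa> h"
  unfolding cond_mean_op_def by (rule adjoint_works[OF bounded_linear_cond_mean_op_adj])

text \<open>Evaluating at \<open>y'\<close> is pairing with the feature of \<open>y'\<close>; the
  adjoint moves the operator across, and reproduction at \<open>x\<close> leaves the integral of
  \<open>l y'\<close>. In particular the embedding exists as an element of the RKHS.\<close>

lemma cond_mean_op_feature: "cond_mean_op evk evl \<kappa> (feat x) = mean_embedding N l evl (\<kappa> x)"
  unfolding mean_embedding_def
proof (rule y.rkhs_elem_eqI[symmetric])
  fix y' assume y': "y' \<in> space N"
  let ?\<psi> = "canonical_feature (space N) l evl"
  have "evl (cond_mean_op evk evl \<kappa> (feat x)) y' = ?\<psi> y' \<bullet> cond_mean_op evk evl \<kappa> (feat x)"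
    using y' by (simp add: y.ev_eq_inner inner_commute)
  also have "\<dots> = evk (cond_mean_op_adj evk evl \<kappa> (?\<psi> y')) x"
    by (simp add: inner_cond_mean_op x.ev_eq_inner)
  also have "\<dots> = (\<integral>y. evl (?\<psi> y') y \<partial>\<kappa> x)"
    by (rule ev_cond_mean_op_adj)
  also have "\<dots> = (\<integral>y. l y' y \<partial>\<kappa> x)"
    using y' by (intro Bochner_Integration.integral_cong refl)
      (simp add: space_kernel y.ev_eq_inner y.inner_feature)
  finally show "evl (cond_mean_op evk evl \<kappa> (feat x)) y' = (\<integral>y. l y' y \<partial>\<kappa> x)" .
qed

end

lemma cond_mean_of_source_condition:
  fixes evk :: "'hx::{real_inner,banach} \<Rightarrow> 'x::topological_space \<Rightarrow> real"
    and evl :: "'hy::{real_inner,banach} \<Rightarrow> 'y \<Rightarrow> real"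
  assumes "rkhs UNIV k evk" and "rkhs (space N) l evl"
    and "regular_cond_distr P borel X N Y \<kappa>" and "source_condition evk evl C \<gamma> \<kappa>"
  shows "cond_mean k evk N l evl \<kappa>"
proof -
  interpret x: rkhs UNIV k evk by fact
  interpret y: rkhs "space N" l evl by fact
  have "\<kappa> x \<in> space (prob_algebra N)" for x
    using assms(3) measurable_space[of \<kappa> borel "prob_algebra N" x]
    by (simp add: regular_cond_distr_def)
  then have "space (\<kappa> x) = space N" for x
    by (intro sets_eq_imp_space_eq) (simp add: space_prob_algebra)
  moreover have src: "integrable (\<kappa> x) (evl g)"
      "(\<lambda>x. \<integral>y. evl g y \<partial>\<kappa> x) \<in> evk ` range (op_powr C \<gamma>)" for g x
    using assms(4) unfolding source_condition_def by blast+
  moreover have "\<exists>f. evk f = (\<lambda>x. \<integral>y. evl g y \<partial>\<kappa> x)" for g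
    using src(2)[of g] by (elim imageE) (rule exI, erule sym)
  ultimately show ?thesis by unfold_locales
qed

section \<open>Mixture measures and the trace formula\<close>

lemma finite_measure_mixture:
  assumes "finite_measure \<mu>" "finite_measure \<nu>" "sets \<nu> = sets \<mu>"
  shows "finite_measure (mixture \<alpha> \<mu> \<nu>)"
proof
  have "emeasure \<mu> (space \<mu>) < \<top>" "emeasure \<nu> (space \<mu>) < \<top>"
    using finite_measure.emeasure_finite[OF assms(1)] finite_measure.emeasure_finite[OF assms(2)]
    by (simp_all add: less_top)
  then show "emeasure (mixture \<alpha> \<mu> \<nu>) (space (mixture \<alpha> \<mu> \<nu>)) \<noteq> \<infinity>"
    by (simp add: emeasure_mixture[OF assms(3)] ennreal_mult_eq_top_iff less_top[symmetric])
qed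

theorem theorem3p2:
  fixes P Q :: "'w measure"
    and X :: "'w \<Rightarrow> 'x::topological_space"
    and N :: "'y measure"
    and Y Z :: "'w \<Rightarrow> 'y"
    and k :: "'x \<Rightarrow> 'x \<Rightarrow> real"
    and evk :: "'hx::{real_inner, banach, second_countable_topology} \<Rightarrow> 'x \<Rightarrow> real"
    and l :: "'y \<Rightarrow> 'y \<Rightarrow> real"
    and evl :: "'hy::{real_inner, banach} \<Rightarrow> 'y \<Rightarrow> real"
    and \<kappa>P \<kappa>Q :: "'x \<Rightarrow> 'y measure"
    and \<alpha> kmax \<gamma>P \<gamma>Q :: real
  defines "PX \<equiv> distr P borel X"
    and "QX \<equiv> distr Q borel X"
  defines "RX \<equiv> mixture \<alpha> PX QX"
  defines "CXX \<equiv> cov_op RX (canonical_feature UNIV k evk)"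
  defines "\<Delta> \<equiv> (\<lambda>h. cond_mean_op evk evl \<kappa>P h - cond_mean_op evk evl \<kappa>Q h)"
  assumes "prob_space P" and "prob_space Q" and "sets Q = sets P"
    and "X \<in> P \<rightarrow>\<^sub>M borel" and "Y \<in> P \<rightarrow>\<^sub>M N" and "Z \<in> P \<rightarrow>\<^sub>M N"
    and "full_support PX" and "full_support QX"
    and "absolutely_continuous PX QX" and "absolutely_continuous QX PX"
    and "0 \<le> \<alpha>" and "\<alpha> \<le> 1"
    and "pos_def_kernel UNIV k" and "rkhs UNIV k evk"
    and "(\<lambda>(x, x'). k x x') \<in> borel_measurable (borel \<Otimes>\<^sub>M borel)"
    and "continuous_on UNIV (\<lambda>(x, x'). k x x')"
    and "\<And>x. k x x \<le> kmax"
    and "pos_def_kernel (space N) l" and "rkhs (space N) l evl"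
    and "(\<lambda>(y, y'). l y y') \<in> borel_measurable (N \<Otimes>\<^sub>M N)"
    and "regular_cond_distr P borel X N Y \<kappa>P"
    and "regular_cond_distr Q borel X N Z \<kappa>Q"
    and "1 / 2 \<le> \<gamma>P" and "source_condition evk evl CXX \<gamma>P \<kappa>P"
    and "1 / 2 \<le> \<gamma>Q" and "source_condition evk evl CXX \<gamma>Q \<kappa>Q"
  shows "(cmmd1 RX N l evl \<kappa>P \<kappa>Q)\<^sup>2 = op_trace (adjoint \<Delta> \<circ> \<Delta> \<circ> CXX)"
proof -
  interpret P: cond_mean k evk N l evl \<kappa>P
    by (rule cond_mean_of_source_condition) fact+
  interpret Q: cond_mean k evk N l evl \<kappa>Q
    by (rule cond_mean_of_source_condition) fact+
  let ?\<phi> = "canonical_feature UNIV k evk"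
  \<comment> \<open>The bounded operators at hand are the ones from the RKHS of \<open>l\<close> to
    that of \<open>k\<close>. Their difference \<open>A\<close> turns out to be
    \<open>adjoint \<Delta>\<close>, and boundedness of \<open>\<Delta>\<close> follows from the
    pairing \<open>adj\<close>.\<close>
  define A where "A g = cond_mean_op_adj evk evl \<kappa>P g - cond_mean_op_adj evk evl \<kappa>Q g" for g
  have A: "bounded_linear A"
    unfolding A_def
    by (intro bounded_linear_sub P.bounded_linear_cond_mean_op_adj Q.bounded_linear_cond_mean_op_adj)
  have adj: "A g \<bullet> h = g \<bullet> \<Delta> h" for g h
    by (simp add: A_def \<Delta>_def inner_diff P.inner_cond_mean_op Q.inner_cond_mean_op)
  then have adjoint_\<Delta>: "adjoint \<Delta> = A"
    by (intro adjoint_unique) (metis inner_commute)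
  have D: "bounded_linear (A \<circ> \<Delta>)"
    unfolding comp_def
    by (intro bounded_linear_compose[OF A] bounded_linear_of_adjoint_pair[OF A adj])
  have sets_RX: "sets RX = sets borel"
    by (simp add: RX_def PX_def)
  have "finite_measure PX" "finite_measure QX"
    unfolding PX_def QX_def using assms
    by (auto intro!: prob_space.finite_measure prob_space.prob_space_distr
        cong: measurable_cong_sets)
  then have R: "finite_measure RX"
    unfolding RX_def by (rule finite_measure_mixture) (simp add: PX_def QX_def)
  have \<phi>: "?\<phi> \<in> borel_measurable RX"
    unfolding measurable_cong_sets[OF sets_RX refl]
    by (intro borel_measurable_continuous_onI continuous_on_feature) fact+
  have bnd: "norm (?\<phi> x) \<le> sqrt kmax" for x
    using \<open>\<And>x. k x x \<le> kmax\<close> by (simp add: P.x.norm_feature)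
  have "op_trace (adjoint \<Delta> \<circ> \<Delta> \<circ> CXX) = (\<integral>x. ?\<phi> x \<bullet> (A \<circ> \<Delta>) (?\<phi> x) \<partial>RX)"
    unfolding CXX_def adjoint_\<Delta> by (rule op_trace_eqI[OF has_trace_cov_op[OF R \<phi> bnd D]])
  \<comment> \<open>Moving \<open>A\<close> across the inner product by \<open>adj\<close> pairs the
    image of the feature under \<open>\<Delta>\<close> with itself.\<close>
  also have "\<dots> = (\<integral>x. (norm (\<Delta> (?\<phi> x)))\<^sup>2 \<partial>RX)"
    by (simp add: power2_norm_eq_inner inner_commute[of "?\<phi> _"] adj)
  also have "\<dots> = (\<integral>x. (norm (mean_embedding N l evl (\<kappa>P x) - mean_embedding N l evl (\<kappa>Q x)))\<^sup>2 \<partial>RX)"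
    by (simp add: \<Delta>_def P.cond_mean_op_feature Q.cond_mean_op_feature)
  \<comment> \<open>The square undoes \<open>sqrt\<close> because the integral is
    nonnegative.\<close>
  also have "\<dots> = (cmmd1 RX N l evl \<kappa>P \<kappa>Q)\<^sup>2"
    by (simp add: cmmd1_def)
  finally show ?thesis by simp
qed

end
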